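(* Suppose that $X=\{\mathbf{x}\in\mathbb{R}^n:\mathbf{l}\le\mathbf{x}\le\mathbf{u}\}$ with $\mathbf{l},\mathbf{u}\in\mathbb{Z}^n$. Let $\bar{\mathbf{x}}\in X\cap\mathbb{Z}^n$ be a solution of the continuous Nash equilibrium problem. Consider a player $\nu$ and suppose that an index $i\in\{1,\dots,n_\nu\}$ exists such that one of the following two possibilities holds: (i) $F^\nu_i(\cdot)$ is a convex function, $\bar x^\nu_i=l^\nu_i$, and for each player $\mu\in\{1,\dots,N\}$ and each index $j\in\{1,\dots,n_\mu\}$ with $(\mu,j)\ne(\nu,i)$: if $\frac{\partial F^\nu_i(\bar{\mathbf{x}})}{\partial x^\mu_j}>0$ then $\bar x^\mu_j=l^\mu_j$, and if $\frac{\partial F^\nu_i(\bar{\mathbf{x}})}{\partial x^\mu_j}<0$ then $\bar x^\mu_j=u^\mu_j$; (ii) $F^\nu_i(\cdot)$ is a concave function, $\bar x^\nu_i=u^\nu_i$, and for each player $\mu\in\{1,\dots,N\}$ and each index $j\in\{1,\dots,n_\mu\}$ with $(\mu,j)\ne(\nu,i)$: if $\frac{\partial F^\nu_i(\bar{\mathbf{x}})}{\partial x^\mu_j}>0$ then $\bar x^\mu_j=u^\mu_j$, and if $\frac{\partial F^\nu_i(\bar{\mathbf{x}})}{\partial x^\mu_j}<0$ then $\bar x^\mu_j=l^\mu_j$. If $\theta_\nu$ is strictly convex with respect to $x^\nu_i$, then no point $\tilde{\mathbf{x}}\in X\cap\mathbb{Z}^n$ with $\tilde x^\nu_i\ne\bar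 x^\nu_i$ is an equilibrium of the discrete Nash equilibrium problem.
   Context: There are $N$ players; player $\nu$ controls $x^\nu\in\mathbb{R}^{n_\nu}$; $n=n_1+\dots+n_N$, $\mathbf{x}=(x^1,\dots,x^N)=(x^\nu,\mathbf{x}^{-\nu})\in\mathbb{R}^n$, where $\mathbf{x}^{-\nu}$ collects the variables of all players other than $\nu$. Components of $\mathbf{l},\mathbf{u}$ are indexed in the same way. $X=\prod_\nu X^\nu$ with $X^\nu\subseteq\mathbb{R}^{n_\nu}$ the (relaxed) feasible set of player $\nu$; here $X^\nu=\{x^\nu:l^\nu\le x^\nu\le u^\nu\}$. Each player $\nu$ has an objective $\theta_\nu:\mathbb{R}^n\to\mathbb{R}$. Discrete Nash equilibrium problem: each player $\nu$ solves $\min_{x^\nu}\theta_\nu(x^\nu,\mathbf{x}^{-\nu})$ subject to $x^\nu\in X^\nu\cap\mathbb{Z}^{n_\nu}$; an equilibrium is $\mathbf{x}_*\in X\cap\mathbb{Z}^n$ such that for all $\nu$, $\theta_\nu(x^\nu_*,\mathbf{x}^{-\nu}_* )\le\theta_\nu(x^\nu,\mathbf{x}^{-\nu}_* )$ for all $x^\nu\in X^\nu\cap\mathbb{Z}^{n_\nu}$. Continuous Nash equilibrium problem: each player $\nu$ solves the same problem without integrality; a solution is $\bar{\mathbf{x}}\in X$ such that for all $\nu$, $\theta_\nu(\bar x^\nu,\bar{\mathbf{x}}^{-\nu})\le\theta_\nu(x^\nu,\bar{\mathbf{x}}^{-\nu})$ for all $x^\nu\in X^\nu$. Standing assumptions: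 each $\theta_\nu$ is continuously differentiable and is convex as a function of $x^\nu$ alone. $F^\nu(\mathbf{x}):=\nabla_{x^\nu}\theta_\nu(\mathbf{x})$, with components $F^\nu_i:\mathbb{R}^n\to\mathbb{R}$; the function $F^\nu_i$ in the statement is assumed differentiable. "Strictly convex with respect to $x^\nu_i$" means that, for any fixed values of all the other variables, $\theta_\nu$ is a strictly convex function of the single real variable $x^\nu_i$. *)

theory Defs
  imports "HOL-Analysis.Analysis"
begin

text \<open>
  The joint variable space is \<^typ>\<open>real^'n\<close>, and a map \<open>own :: 'n \<Rightarrow> 'p\<close> assigns each coordinate to the
  player who controls it. The double index \<open>(\<nu>, i)\<close> thus becomes a single coordinate \<open>i\<close> with
  \<open>own i = \<nu>\<close>, and the numbers of variables of the players may differ.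
  A strategy of player \<open>\<nu>\<close> is represented by any vector in \<^typ>\<open>real^'n\<close> carrying it in the
  coordinates owned by \<open>\<nu>\<close>; the remaining coordinates are irrelevant. Accordingly a subset of the
  strategy space of \<open>\<nu>\<close> is represented by its cylinder in \<^typ>\<open>real^'n\<close>.
\<close>

text \<open>The joint point \<open>(y\<^sup>\<nu>, x\<^sup>-\<^sup>\<nu>)\<close>.\<close>

definition joint :: "('n \<Rightarrow> 'p) \<Rightarrow> 'p \<Rightarrow> real^'n \<Rightarrow> real^'n \<Rightarrow> real^'n" where
  "joint own \<nu> y x = (\<chi> k. if own k = \<nu> then y $ k else x $ k)"

definition box_strategies :: "('n \<Rightarrow> 'p) \<Rightarrow> real^'n \<Rightarrow> real^'n \<Rightarrow> 'p \<Rightarrow> (real^'n) set" where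
  "box_strategies own l u \<nu> = {y. \<forall>k. own k = \<nu> \<longrightarrow> l $ k \<le> y $ k \<and> y $ k \<le> u $ k}"

definition int_strategies :: "('n \<Rightarrow> 'p) \<Rightarrow> 'p \<Rightarrow> (real^'n) set" where
  "int_strategies own \<nu> = {y. \<forall>k. own k = \<nu> \<longrightarrow> y $ k \<in> \<int>}"

definition int_vectors :: "(real^'n) set" where
  "int_vectors = {x. \<forall>k. x $ k \<in> \<int>}"

text \<open>Equilibria for arbitrary strategy sets \<open>S \<nu>\<close>, given as cylinders.\<close>

definition nash_equilibrium ::
  "('n \<Rightarrow> 'p) \<Rightarrow> ('p \<Rightarrow> (real^'n) set) \<Rightarrow> ('p \<Rightarrow> real^'n \<Rightarrow> real) \<Rightarrow> real^'n \<Rightarrow> bool" where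
  "nash_equilibrium own S \<theta> x \<longleftrightarrow>
     (\<forall>\<nu>. x \<in> S \<nu>) \<and>
     (\<forall>\<nu>. \<forall>y \<in> S \<nu>. \<theta> \<nu> (joint own \<nu> x x) \<le> \<theta> \<nu> (joint own \<nu> y x))"

definition continuous_nash ::
  "('n \<Rightarrow> 'p) \<Rightarrow> real^'n \<Rightarrow> real^'n \<Rightarrow> ('p \<Rightarrow> real^'n \<Rightarrow> real) \<Rightarrow> real^'n \<Rightarrow> bool" where
  "continuous_nash own l u = nash_equilibrium own (box_strategies own l u)"

definition discrete_nash ::
  "('n \<Rightarrow> 'p) \<Rightarrow> real^'n \<Rightarrow> real^'n \<Rightarrow> ('p \<Rightarrow> real^'n \<Rightarrow> real) \<Rightarrow> real^'n \<Rightarrow> bool" where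
  "discrete_nash own l u =
     nash_equilibrium own (\<lambda>\<nu>. box_strategies own l u \<nu> \<inter> int_strategies own \<nu>)"

definition coord_upd :: "real^'n \<Rightarrow> 'n \<Rightarrow> real \<Rightarrow> real^'n" where
  "coord_upd x i t = (\<chi> k. if k = i then t else x $ k)"

definition partial_deriv :: "'n \<Rightarrow> (real^'n \<Rightarrow> real) \<Rightarrow> real^'n \<Rightarrow> real" where
  "partial_deriv i f x = deriv (\<lambda>t. f (coord_upd x i t)) (x $ i)"

definition continuously_differentiable :: "(real^'n \<Rightarrow> real) \<Rightarrow> bool" where
  "continuously_differentiable f \<longleftrightarrow>
     (\<exists>g. continuous_on UNIV g \<and> (\<forall>x. GDERIV f x :> g x))"

definition convex_in_block :: "('n \<Rightarrow> 'p) \<Rightarrow> 'p \<Rightarrow> (real^'n \<Rightarrow> real) \<Rightarrow> bool" where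
  "convex_in_block own \<nu> f \<longleftrightarrow> (\<forall>x. convex_on UNIV (\<lambda>y. f (joint own \<nu> y x)))"

definition strictly_convex_on :: "'a::real_vector set \<Rightarrow> ('a \<Rightarrow> real) \<Rightarrow> bool" where
  "strictly_convex_on S f \<longleftrightarrow>
     convex S \<and>
     (\<forall>x\<in>S. \<forall>y\<in>S. \<forall>t. x \<noteq> y \<longrightarrow> 0 < t \<longrightarrow> t < 1 \<longrightarrow>
        f ((1 - t) *\<^sub>R x + t *\<^sub>R y) < (1 - t) * f x + t * f y)"

definition strictly_convex_in_coord :: "'n \<Rightarrow> (real^'n \<Rightarrow> real) \<Rightarrow> bool" where
  "strictly_convex_in_coord i f \<longleftrightarrow>
     (\<forall>x. strictly_convex_on UNIV (\<lambda>t. f (coord_upd x i t)))"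

text \<open>
  For \<open>own i = \<nu>\<close> this is the component \<open>F\<^sup>\<nu>\<^sub>i\<close> of \<open>F\<^sup>\<nu> = \<nabla>\<^bsub>x\<^sup>\<nu>\<^esub> \<theta>\<^sub>\<nu>\<close>.
\<close>

definition game_grad :: "('p \<Rightarrow> real^'n \<Rightarrow> real) \<Rightarrow> 'p \<Rightarrow> 'n \<Rightarrow> real^'n \<Rightarrow> real" where
  "game_grad \<theta> \<nu> i = partial_deriv i (\<theta> \<nu>)"

lemma joint_same: "joint own \<nu> x x = x"
  by (simp add: joint_def)

lemma box_eq_product: "{l..u} = (\<Inter>\<nu>. box_strategies own l u \<nu>)"
  for l u :: "real^'n"
  by (auto simp: box_strategies_def less_eq_vec_def)

lemma int_vectors_eq_product: "int_vectors = (\<Inter>\<nu>. int_strategies own \<nu>)"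
  by (auto simp: int_vectors_def int_strategies_def)

lemma partial_deriv_eq_gradient:
  assumes "GDERIV f x :> g"
  shows "partial_deriv i f x = g $ i"
proof -
  have upd: "coord_upd x i t = x + (t - x $ i) *\<^sub>R axis i 1" for t
    by (simp add: coord_upd_def vec_eq_iff axis_def)
  have f: "(f has_derivative (\<lambda>h. inner h g)) (at (x + (x $ i - x $ i) *\<^sub>R axis i 1))"
    using assms by (simp add: gderiv_def)
  have "((\<lambda>t. x + (t - x $ i) *\<^sub>R axis i 1) has_derivative (\<lambda>h. h *\<^sub>R axis i 1)) (at (x $ i))"
    by (auto intro!: derivative_eq_intros)
  from has_derivative_compose[OF this f]
  have "((\<lambda>t. f (coord_upd x i t)) has_field_derivative g $ i) (at (x $ i))"
    by (simp add: upd has_field_derivative_def inner_axis' mult_commute_abs)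
  then show ?thesis
    by (simp add: partial_deriv_def DERIV_imp_deriv)
qed

end

theory Submission
  imports Defs
begin

text \<open>
  The two cases are mirror images, so a sign \<open>s\<close> is carried along: \<open>s = 1\<close> when \<open>xbar\<close> sits on the
  lower bound in coordinate \<open>i\<close>, \<open>s = - 1\<close> when it sits on the upper one. In both cases
  \<open>s * (x $ i - xbar $ i) \<ge> 0\<close> on the whole box, \<open>s * F\<close> is convex for \<open>F = game_grad \<theta> \<nu> i\<close>, and each
  summand \<open>s * partial_deriv j F xbar * (x $ j - xbar $ j)\<close> is nonnegative for \<open>j \<noteq> i\<close>. The summand
  \<open>j = i\<close> is nonnegative as well, because \<open>F\<close> is a partial derivative of \<open>\<theta> \<nu>\<close> in a variable in which
  \<open>\<theta> \<nu>\<close> is convex, hence increasing in that variable. Furthermore \<open>s * F xbar \<ge> 0\<close>: this is the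
  first-order optimality condition for the owner of \<open>i\<close>, who can move into the box in direction \<open>s\<close>
  as soon as the box contains a point \<open>xt\<close> with \<open>xt $ i \<noteq> xbar $ i\<close>.

  The tangent inequality for the convex function \<open>s * F\<close> at \<open>xbar\<close> therefore gives \<open>s * F y \<ge> 0\<close> for
  all \<open>y\<close> in the box: the sign that \<open>F\<close> has at the equilibrium spreads to the whole box. At an integer
  point \<open>xt\<close> with \<open>xt $ i \<noteq> xbar $ i\<close>, the step of length one towards \<open>xbar\<close> in coordinate \<open>i\<close> stays
  integer and inside the box. With \<open>y\<close> the point it reaches, strict convexity yields
  \<open>\<theta> \<nu> xt > \<theta> \<nu> y + s * F y \<ge> \<theta> \<nu> y\<close>, so the owner of \<open>i\<close> improves and \<open>xt\<close> is not a discrete equilibrium.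
\<close>

lemma coord_upd_simps [simp]:
  "coord_upd x i t $ i = t"
  "coord_upd (coord_upd x i t) i t' = coord_upd x i t'"
  "coord_upd x i (x $ i) = x"
  by (simp_all add: coord_upd_def vec_eq_iff)

lemma joint_coord_upd: "own i = \<nu> \<Longrightarrow> joint own \<nu> (coord_upd x i t) x = coord_upd x i t"
  by (auto simp: joint_def coord_upd_def vec_eq_iff)

lemma coord_upd_in_box:
  fixes x :: "real^'n"
  assumes "x \<in> {l..u}" "l $ i \<le> t" "t \<le> u $ i"
  shows "coord_upd x i t \<in> {l..u}"
  using assms by (auto simp: coord_upd_def less_eq_vec_def)

lemma has_real_derivative_along_coord:
  assumes "GDERIV f (coord_upd x i t) :> g"
  shows "((\<lambda>t. f (coord_upd x i t)) has_real_derivative partial_deriv i f (coord_upd x i t)) (at t)"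
proof -
  have upd: "coord_upd x i r = coord_upd x i t + (r - t) *\<^sub>R axis i 1" for r
    by (simp add: coord_upd_def vec_eq_iff axis_def)
  have f: "(f has_derivative (\<lambda>h. inner h g)) (at (coord_upd x i t + (t - t) *\<^sub>R axis i 1))"
    using assms by (simp add: gderiv_def)
  have "((\<lambda>r. coord_upd x i t + (r - t) *\<^sub>R axis i 1) has_derivative (\<lambda>h. h *\<^sub>R axis i 1)) (at t)"
    by (auto intro!: derivative_eq_intros)
  from has_derivative_compose[OF this f]
  have "((\<lambda>r. f (coord_upd x i r)) has_real_derivative g $ i) (at t)"
    by (simp add: upd[symmetric] has_field_derivative_def inner_axis' mult_commute_abs)
  then show ?thesis
    by (simp add: partial_deriv_eq_gradient[OF assms])
qed

lemma differentiable_imp_GDERIV: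
  fixes f :: "'a::euclidean_space \<Rightarrow> real"
  assumes "f differentiable (at x)"
  obtains g where "GDERIV f x :> g"
proof -
  from assms obtain D where D: "(f has_derivative D) (at x)"
    by (auto simp: differentiable_def)
  have "D h = inner h (adjoint D 1)" for h
    using adjoint_works[OF has_derivative_linear[OF D], of h 1] by simp
  then have "D = (\<lambda>h. inner h (adjoint D 1))"
    by blast
  with D show ?thesis
    using that[of "adjoint D 1"] by (simp add: gderiv_def)
qed

text \<open>
  Restricting \<open>f\<close> to the line through \<open>a\<close> and \<open>b\<close>, parametrised by \<open>h\<close>, reduces the inequality to the
  tangent inequality for convex functions of a real variable.
\<close>

lemma convex_above_gradient_tangent:
  fixes f :: "'a::euclidean_space \<Rightarrow> real"
  assumes cvx: "convex_on UNIV f" and f: "GDERIV f a :> g"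
  shows "f a + inner (b - a) g \<le> f b"
proof -
  let ?h = "\<lambda>t::real. f (a + t *\<^sub>R (b - a))"
  have "convex_on UNIV ?h"
  proof (rule convex_onI)
    fix t x y :: real
    assume t: "0 < t" "t < 1"
    have "a + ((1 - t) *\<^sub>R x + t *\<^sub>R y) *\<^sub>R (b - a)
        = (1 - t) *\<^sub>R (a + x *\<^sub>R (b - a)) + t *\<^sub>R (a + y *\<^sub>R (b - a))"
      by (simp add: algebra_simps)
    then show "?h ((1 - t) *\<^sub>R x + t *\<^sub>R y) \<le> (1 - t) * ?h x + t * ?h y"
      using convex_onD[OF cvx, of t "a + x *\<^sub>R (b - a)" "a + y *\<^sub>R (b - a)"] t by simp
  qed simp
  moreover have "(?h has_real_derivative inner (b - a) g) (at 0)"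
  proof -
    have f': "(f has_derivative (\<lambda>h. inner h g)) (at (a + 0 *\<^sub>R (b - a)))"
      using f by (simp add: gderiv_def)
    have "((\<lambda>t::real. a + t *\<^sub>R (b - a)) has_derivative (\<lambda>t. t *\<^sub>R (b - a))) (at 0)"
      by (auto intro!: derivative_eq_intros)
    from has_derivative_compose[OF this f'] show ?thesis
      by (simp add: has_field_derivative_def mult_commute_abs)
  qed
  ultimately have "inner (b - a) g * (1 - 0) \<le> ?h 1 - ?h 0"
    by (intro convex_on_imp_above_tangent[where A = UNIV]) auto
  then show ?thesis by simp
qed

text \<open>
  The midpoint \<open>m\<close> of \<open>a\<close> and \<open>b\<close> lies weakly above the tangent at \<open>a\<close> and strictly below the chord,
  which forces the end point \<open>b\<close> strictly above the tangent.
\<close>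

lemma strictly_convex_above_tangent:
  fixes f :: "real \<Rightarrow> real"
  assumes sc: "strictly_convex_on UNIV f" and f: "(f has_real_derivative d) (at a)" and "a \<noteq> b"
  shows "f a + d * (b - a) < f b"
proof -
  have "f ((1 - t) *\<^sub>R x + t *\<^sub>R y) \<le> (1 - t) * f x + t * f y" if "0 < t" "t < 1" for t x y
  proof (cases "x = y")
    case True
    then show ?thesis by (simp add: algebra_simps)
  next
    case False
    then show ?thesis
      using sc that by (auto simp: strictly_convex_on_def intro!: less_imp_le)
  qed
  then have cvx: "convex_on UNIV f"
    by (intro convex_onI) auto
  define m where "m = (a + b) / 2"
  have m: "m = (1 - 1/2) *\<^sub>R a + (1/2) *\<^sub>R b"
    by (simp add: m_def field_simps)
  have "d * (m - a) \<le> f m - f a"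
    by (rule convex_on_imp_above_tangent[OF cvx]) (use f in auto)
  moreover have "m - a = (b - a) / 2"
    by (simp add: m_def field_simps)
  moreover have "f m < (1 - 1/2) * f a + (1/2) * f b"
    using sc[unfolded strictly_convex_on_def, THEN conjunct2, rule_format, of a b "1/2"] \<open>a \<noteq> b\<close>
    unfolding m by simp
  ultimately show ?thesis by simp
qed

lemma strictly_convex_derivative_mono:
  fixes f f' :: "real \<Rightarrow> real"
  assumes sc: "strictly_convex_on UNIV f" and f: "\<And>t. (f has_real_derivative f' t) (at t)"
  shows "mono f'"
proof (rule monoI)
  fix a b :: real
  assume "a \<le> b"
  show "f' a \<le> f' b"
  proof (cases "a = b")
    case False
    have "f a + f' a * (b - a) < f b" "f b + f' b * (a - b) < f a"
      by (rule strictly_convex_above_tangent[OF sc f]; use False in simp)+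
    then have "0 < (f' b - f' a) * (b - a)"
      by (simp add: algebra_simps)
    with \<open>a \<le> b\<close> show ?thesis
      by (simp add: zero_less_mult_iff)
  qed simp
qed

text \<open>
  First-order optimality at a boundary point: only steps in direction \<open>s\<close> are available there, so
  the derivative is controlled in that direction alone.
\<close>

lemma one_sided_min_derivative:
  fixes f :: "real \<Rightarrow> real"
  assumes f: "(f has_real_derivative d) (at a)" and "\<epsilon> > 0"
    and min: "\<And>h. 0 \<le> h \<Longrightarrow> h \<le> \<epsilon> \<Longrightarrow> f a \<le> f (a + s * h)"
  shows "0 \<le> s * d"
proof (rule ccontr)
  assume "\<not> 0 \<le> s * d"
  moreover have "((\<lambda>h. f (a + s * h)) has_real_derivative s * d) (at 0)"
  proof -
    have "((\<lambda>h. a + s * h) has_real_derivative s) (at 0)"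
      by (auto intro!: derivative_eq_intros)
    from DERIV_chain2[of f d "\<lambda>h. a + s * h" 0, OF _ this] f show ?thesis
      by (simp add: mult.commute)
  qed
  ultimately obtain \<delta> where \<delta>: "\<delta> > 0" "\<And>h. 0 < h \<Longrightarrow> h < \<delta> \<Longrightarrow> f (a + s * h) < f a"
    using DERIV_neg_dec_right[of "\<lambda>h. f (a + s * h)" "s * d" 0] by auto
  let ?h = "min (\<delta> / 2) \<epsilon>"
  have "f (a + s * ?h) < f a" "f a \<le> f (a + s * ?h)"
    using \<delta> \<open>\<epsilon> > 0\<close> by (auto intro!: \<delta>(2) min)
  then show False by simp
qed

lemma distinct_ints_diff_ge_1:
  fixes a b :: real
  assumes "a \<in> \<int>" "b \<in> \<int>" "a \<noteq> b"
  shows "1 \<le> \<bar>a - b\<bar>"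
  using Ints_nonzero_abs_ge1[of "a - b"] assms by simp

text \<open>
  Carrying \<open>s\<close> along makes one argument serve both faces. The hypothesis \<open>dir\<close> says that \<open>xbar\<close> lies on the face of the box from
  which direction \<open>s\<close> points inwards; \<open>others\<close> says that moving in any other coordinate within the box
  does not decrease \<open>s * F\<close> to first order.
\<close>

lemma no_discrete_nash_off_face:
  fixes own :: "'n::finite \<Rightarrow> 'p"
    and \<theta> :: "'p \<Rightarrow> real^'n \<Rightarrow> real" and l u xbar xt :: "real^'n"
    and \<nu> :: 'p and i :: 'n and s :: real
  defines "F \<equiv> game_grad \<theta> \<nu> i"
  assumes grad: "\<And>x. \<exists>g. GDERIV (\<theta> \<nu>) x :> g"
    and xbar: "xbar \<in> {l..u}" "xbar $ i \<in> \<int>" "continuous_nash own l u \<theta> xbar"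
    and own_i: "own i = \<nu>"
    and F_diff: "F differentiable (at xbar)"
    and strict: "strictly_convex_in_coord i (\<theta> \<nu>)"
    and s: "s = 1 \<or> s = - 1"
    and cvx: "convex_on UNIV (\<lambda>x. s * F x)"
    and dir: "\<And>x. x \<in> {l..u} \<Longrightarrow> 0 \<le> s * (x $ i - xbar $ i)"
    and others: "\<And>x j. x \<in> {l..u} \<Longrightarrow> j \<noteq> i \<Longrightarrow>
      0 \<le> s * (partial_deriv j F xbar * (x $ j - xbar $ j))"
    and xt: "xt \<in> {l..u}" "xt \<in> int_vectors" "xt $ i \<noteq> xbar $ i"
  shows "\<not> discrete_nash own l u \<theta> xt"
proof
  assume nash: "discrete_nash own l u \<theta> xt"
  have bounds: "l $ k \<le> x $ k" "x $ k \<le> u $ k" if "x \<in> {l..u}" for x k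
    using that by (auto simp: less_eq_vec_def)
  have dF: "((\<lambda>t. \<theta> \<nu> (coord_upd x i t)) has_real_derivative F (coord_upd x i t)) (at t)" for x t
    unfolding F_def game_grad_def using grad has_real_derivative_along_coord by blast
  have sc: "strictly_convex_on UNIV (\<lambda>t. \<theta> \<nu> (coord_upd x i t))" for x
    using strict by (simp add: strictly_convex_in_coord_def)
  have gap: "1 \<le> s * (xt $ i - xbar $ i)"
    using distinct_ints_diff_ge_1[of "xt $ i" "xbar $ i"] xt xbar(2) dir[OF xt(1)] s
    by (auto simp: int_vectors_def)
  obtain g where g: "GDERIV F xbar :> g"
    using differentiable_imp_GDERIV[OF F_diff] .
  have g_eq: "g $ j = partial_deriv j F xbar" for j
    using partial_deriv_eq_gradient[OF g] by simp

  have F_xbar: "0 \<le> s * F xbar"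
  proof (rule one_sided_min_derivative[where \<epsilon> = 1])
    show "((\<lambda>t. \<theta> \<nu> (coord_upd xbar i t)) has_real_derivative F xbar) (at (xbar $ i))"
      using dF[of xbar "xbar $ i"] by simp
  next
    fix h :: real
    assume h: "0 \<le> h" "h \<le> 1"
    let ?y = "coord_upd xbar i (xbar $ i + s * h)"
    \<comment> \<open>The deviation stays between \<open>xbar $ i\<close> and \<open>xt $ i\<close>, which differ by at least one.\<close>
    have "?y \<in> {l..u}"
      using coord_upd_in_box[OF xbar(1)] bounds[OF xbar(1), of i] bounds[OF xt(1), of i] h gap s
      by auto
    then have "?y \<in> box_strategies own l u \<nu>"
      using box_eq_product[of l u own] by blast
    then have "\<theta> \<nu> (joint own \<nu> xbar xbar) \<le> \<theta> \<nu> (joint own \<nu> ?y xbar)"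
      using xbar(3) by (auto simp: continuous_nash_def nash_equilibrium_def)
    then show "\<theta> \<nu> (coord_upd xbar i (xbar $ i)) \<le> \<theta> \<nu> ?y"
      by (simp add: joint_same joint_coord_upd own_i)
  qed simp

  have F_i: "0 \<le> partial_deriv i F xbar"
  proof (rule mono_on_imp_deriv_nonneg)
    show "mono_on UNIV (\<lambda>t. F (coord_upd xbar i t))"
      using strictly_convex_derivative_mono[OF sc dF] by simp
    show "((\<lambda>t. F (coord_upd xbar i t)) has_real_derivative partial_deriv i F xbar) (at (xbar $ i))"
      using has_real_derivative_along_coord[of F xbar i "xbar $ i" g] g by simp
  qed simp

  have F_box: "0 \<le> s * F y" if y: "y \<in> {l..u}" for y
  proof -
    have "GDERIV (\<lambda>x. s * F x) xbar :> s *\<^sub>R g"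
      using has_derivative_mult_right[OF g[unfolded gderiv_def], of s] by (simp add: gderiv_def)
    from convex_above_gradient_tangent[OF cvx this]
    have "s * F xbar + inner (y - xbar) (s *\<^sub>R g) \<le> s * F y" .
    moreover have "inner (y - xbar) (s *\<^sub>R g)
        = (\<Sum>j\<in>UNIV. s * (partial_deriv j F xbar * (y $ j - xbar $ j)))"
      by (simp add: inner_vec_def g_eq algebra_simps)
    moreover have "0 \<le> (\<Sum>j\<in>UNIV. s * (partial_deriv j F xbar * (y $ j - xbar $ j)))"
    proof (rule sum_nonneg)
      fix j
      show "0 \<le> s * (partial_deriv j F xbar * (y $ j - xbar $ j))"
      proof (cases "j = i")
        case True
        then show ?thesis
          using mult_nonneg_nonneg[OF F_i dir[OF y]] by (simp add: algebra_simps)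
      qed (use others[OF y] in blast)
    qed
    ultimately show ?thesis using F_xbar by linarith
  qed

  \<comment> \<open>The profitable deviation: one integer step from \<open>xt\<close> towards the face containing \<open>xbar\<close>.\<close>
  let ?y = "coord_upd xt i (xt $ i - s)"
  have y_box: "?y \<in> {l..u}"
    using coord_upd_in_box[OF xt(1)] bounds[OF xbar(1), of i] bounds[OF xt(1), of i] gap s
    by auto
  have "?y \<in> int_vectors"
    using xt(2) s by (auto simp: int_vectors_def coord_upd_def)
  then have "?y \<in> box_strategies own l u \<nu> \<inter> int_strategies own \<nu>"
    using y_box box_eq_product[of l u own] int_vectors_eq_product[of own] by blast
  then have "\<theta> \<nu> (joint own \<nu> xt xt) \<le> \<theta> \<nu> (joint own \<nu> ?y xt)"
    using nash by (auto simp: discrete_nash_def nash_equilibrium_def)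
  then have "\<theta> \<nu> xt \<le> \<theta> \<nu> ?y"
    by (simp add: joint_same joint_coord_upd own_i)
  moreover have "\<theta> \<nu> ?y + F ?y * s < \<theta> \<nu> xt"
    using strictly_convex_above_tangent[OF sc dF, of "xt $ i - s" "xt $ i" xt] s by auto
  ultimately show False
    using F_box[OF y_box] by (simp add: mult.commute)
qed

theorem proposition3p3:
  fixes own :: "'n::finite \<Rightarrow> 'p::finite"
    and \<theta> :: "'p \<Rightarrow> real^'n \<Rightarrow> real"
    and l u xbar :: "real^'n"
    and \<nu> :: 'p and i :: 'n
  assumes C1: "\<And>\<mu>. continuously_differentiable (\<theta> \<mu>)"
    and convex: "\<And>\<mu>. convex_in_block own \<mu> (\<theta> \<mu>)"
    and bounds_int: "l \<in> int_vectors" "u \<in> int_vectors"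
    and xbar_feasible: "xbar \<in> {l..u} \<inter> int_vectors"
    and xbar_nash: "continuous_nash own l u \<theta> xbar"
    and own_i: "own i = \<nu>"
    and F_diff: "\<And>x. game_grad \<theta> \<nu> i differentiable (at x)"
    and cases:
      "(convex_on UNIV (game_grad \<theta> \<nu> i) \<and> xbar $ i = l $ i \<and>
        (\<forall>\<mu> j. own j = \<mu> \<and> (\<mu>, j) \<noteq> (\<nu>, i) \<longrightarrow>
          (partial_deriv j (game_grad \<theta> \<nu> i) xbar > 0 \<longrightarrow> xbar $ j = l $ j) \<and>
          (partial_deriv j (game_grad \<theta> \<nu> i) xbar < 0 \<longrightarrow> xbar $ j = u $ j)))
       \<or>
       (concave_on UNIV (game_grad \<theta> \<nu> i) \<and> xbar $ i = u $ i \<and>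
        (\<forall>\<mu> j. own j = \<mu> \<and> (\<mu>, j) \<noteq> (\<nu>, i) \<longrightarrow>
          (partial_deriv j (game_grad \<theta> \<nu> i) xbar > 0 \<longrightarrow> xbar $ j = u $ j) \<and>
          (partial_deriv j (game_grad \<theta> \<nu> i) xbar < 0 \<longrightarrow> xbar $ j = l $ j)))"
    and strict: "strictly_convex_in_coord i (\<theta> \<nu>)"
  shows "\<forall>xt \<in> {l..u} \<inter> int_vectors. xt $ i \<noteq> xbar $ i \<longrightarrow> \<not> discrete_nash own l u \<theta> xt"
proof (intro ballI impI)
  fix xt
  assume xt: "xt \<in> {l..u} \<inter> int_vectors" and ne: "xt $ i \<noteq> xbar $ i"
  have grad: "\<exists>g. GDERIV (\<theta> \<nu>) x :> g" for x
    using C1[of \<nu>] by (auto simp: continuously_differentiable_def)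
  have xbar_i: "xbar \<in> {l..u}" "xbar $ i \<in> \<int>"
    using xbar_feasible by (auto simp: int_vectors_def)
  have bounds: "l $ k \<le> x $ k" "x $ k \<le> u $ k" if "x \<in> {l..u}" for x k
    using that by (auto simp: less_eq_vec_def)
  let ?F = "game_grad \<theta> \<nu> i"
  note core = no_discrete_nash_off_face[where xbar = xbar and i = i and \<nu> = \<nu>,
      OF grad xbar_i xbar_nash own_i F_diff strict]
  from cases show "\<not> discrete_nash own l u \<theta> xt"
  proof (elim disjE conjE)
    assume cvx: "convex_on UNIV ?F" and lo: "xbar $ i = l $ i"
      and sgn: "\<forall>\<mu> j. own j = \<mu> \<and> (\<mu>, j) \<noteq> (\<nu>, i) \<longrightarrow>
          (partial_deriv j ?F xbar > 0 \<longrightarrow> xbar $ j = l $ j) \<and>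
          (partial_deriv j ?F xbar < 0 \<longrightarrow> xbar $ j = u $ j)"
    have "0 \<le> partial_deriv j ?F xbar * (x $ j - xbar $ j)" if "x \<in> {l..u}" "j \<noteq> i" for x j
      using sgn[rule_format, of j] that bounds[OF that(1), of j]
      by (cases "partial_deriv j ?F xbar" "0::real" rule: linorder_cases)
        (auto intro: mult_nonneg_nonneg mult_nonpos_nonpos)
    then show ?thesis
      using cvx lo bounds(1)[of _ i] xt ne by (intro core[where s = 1]) simp_all
  next
    assume ccv: "concave_on UNIV ?F" and up: "xbar $ i = u $ i"
      and sgn: "\<forall>\<mu> j. own j = \<mu> \<and> (\<mu>, j) \<noteq> (\<nu>, i) \<longrightarrow>
          (partial_deriv j ?F xbar > 0 \<longrightarrow> xbar $ j = u $ j) \<and>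
          (partial_deriv j ?F xbar < 0 \<longrightarrow> xbar $ j = l $ j)"
    have "partial_deriv j ?F xbar * (x $ j - xbar $ j) \<le> 0" if "x \<in> {l..u}" "j \<noteq> i" for x j
      using sgn[rule_format, of j] that bounds[OF that(1), of j]
      by (cases "partial_deriv j ?F xbar" "0::real" rule: linorder_cases)
        (auto intro: mult_nonneg_nonpos mult_nonpos_nonneg)
    then show ?thesis
      using ccv up bounds(2)[of _ i] xt ne by (intro core[where s = "- 1"])
        (simp_all add: concave_on_def)
  qed
qed

end
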